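(* Let $I\subseteq\mathbb{N}$ be defined by $$I:=\bigcup_{i=1}^\infty\,[\,i^2,i^2+i\,)\cap\mathbb{N}$$ and let $J=\mathbb{N}\setminus I$. Then neither of the closed sets $A_I$ and $A_J$ is $\sigma$-lower porous (in $\mathbb{R}$), while the product $A_I\times A_J$ is lower porous (in $\mathbb{R}^2$ with the maximum metric).
   Context: Here $\mathbb{N}=\{1,2,3,\dots\}$. For $n\in\mathbb{N}$ let $$D_n:=\bigcup_{i=0}^{3^{n-1}-1}\Big(\frac{1+3i}{3^n},\frac{2+3i}{3^n}\Big)\subseteq(0,1),$$ and for nonempty $I\subseteq\mathbb{N}$ let $D_I:=\bigcup_{n\in I}D_n$ and $A_I:=[0,1]\setminus D_I$. Let $(X,\rho)$ be a metric space; $B(x,r)$ denotes the open ball with centre $x$ and radius $r$. For $M\subseteq X$, $x\in X$, $R>0$ put $$\gamma(x,R,M)=\sup\{r>0:\ \text{for some } z\in X,\ B(z,r)\subseteq B(x,R)\setminus M\}$$ (with $\sup\emptyset=0$), and $\underline{p}(M,x)=\liminf_{R\to0_+}\frac{2\gamma(x,R,M)}{R}$. The set $M$ is lower porous at $x$ if $\underline{p}(M,x)>0$; $M$ is lower porous (in $X$) if it is lower porous at each of its points; $M$ is $\sigma$-lower porous (in $X$) if it is a countable union of lower porous sets. $\mathbb{R}$ carries the usual metric, and the maximum metric on $\mathbb{R}^2$ is $\rho_m([x_1;y_1],[x_2;y_2])=\max\{|x_1-x_2|,|y_1-y_2|\}$, where $[x;y]$ denotes an ordered pair. *)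

theory Defs
  imports "HOL-Analysis.Analysis"
begin

text \<open>
  Since \<^const>\<open>mball_of\<close> is empty for a centre outside the space, the condition
  \<open>z \<in> mspace m\<close> cannot be dropped. The supremum is taken in \<^typ>\<open>ennreal\<close>: the
  supremum of the empty set is then 0, and an unbounded set has supremum \<open>\<infinity>\<close>.
\<close>

definition porosity_gamma :: "'a metric \<Rightarrow> 'a \<Rightarrow> real \<Rightarrow> 'a set \<Rightarrow> ennreal" where
  "porosity_gamma m x R M =
     Sup (ennreal ` {r. r > 0 \<and> (\<exists>z\<in>mspace m. mball_of m z r \<subseteq> mball_of m x R - M)})"

definition lower_porosity :: "'a metric \<Rightarrow> 'a set \<Rightarrow> 'a \<Rightarrow> ennreal" where
  "lower_porosity m M x = Liminf (at_right 0) (\<lambda>R. 2 * porosity_gamma m x R M / ennreal R)"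

definition lower_porous_at :: "'a metric \<Rightarrow> 'a set \<Rightarrow> 'a \<Rightarrow> bool" where
  "lower_porous_at m M x \<longleftrightarrow> lower_porosity m M x > 0"

definition lower_porous :: "'a metric \<Rightarrow> 'a set \<Rightarrow> bool" where
  "lower_porous m M \<longleftrightarrow> M \<subseteq> mspace m \<and> (\<forall>x\<in>M. lower_porous_at m M x)"

definition sigma_lower_porous :: "'a metric \<Rightarrow> 'a set \<Rightarrow> bool" where
  "sigma_lower_porous m M \<longleftrightarrow>
     (\<exists>\<F>. countable \<F> \<and> (\<forall>S\<in>\<F>. lower_porous m S) \<and> M = \<Union>\<F>)"

definition max_dist :: "real \<times> real \<Rightarrow> real \<times> real \<Rightarrow> real" where
  "max_dist p q = max \<bar>fst p - fst q\<bar> \<bar>snd p - snd q\<bar>"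

definition max_metric :: "(real \<times> real) metric" where
  "max_metric = metric (UNIV, max_dist)"

lemma Metric_space_max_dist: "Metric_space UNIV max_dist"
  by unfold_locales (auto simp: max_dist_def max_def prod_eq_iff abs_if)

lemma mspace_max_metric [simp]: "mspace max_metric = UNIV"
  by (simp add: max_metric_def Metric_space.mspace_metric[OF Metric_space_max_dist])

lemma mdist_max_metric [simp]: "mdist max_metric = max_dist"
  by (simp add: max_metric_def Metric_space.mdist_metric[OF Metric_space_max_dist])

text \<open>Only used for \<open>n \<ge> 1\<close>, so the subtraction in the exponent does not truncate.\<close>

definition D_level :: "nat \<Rightarrow> real set" where
  "D_level n = (\<Union>i<3 ^ (n - 1). {(1 + 3 * real i) / 3 ^ n <..< (2 + 3 * real i) / 3 ^ n})"

definition D_set :: "nat set \<Rightarrow> real set" where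
  "D_set I = (\<Union>n\<in>I. D_level n)"

definition A_set :: "nat set \<Rightarrow> real set" where
  "A_set I = {0..1} - D_set I"

end

theory Submission
  imports Defs
begin

text \<open>
  A multiple of \<open>3 ^ (-N)\<close> lies in no \<open>D_level m\<close> with \<open>m \<ge> N\<close>. A long gap
  \<open>n + 1, \<dots>, n + L\<close> in \<open>I\<close> therefore makes \<open>A_set I\<close> a \<open>3 ^ (-n-L)\<close>-net in
  every triadic interval of level \<open>n\<close> that is not removed by the levels \<open>\<le> n\<close>. By the Baire category
  theorem, a closed \<open>\<sigma>\<close>-lower porous set has a nonempty portion which is lower porous with uniform
  constants, which is impossible for \<open>A_set I\<close> if \<open>I\<close> has arbitrarily long gaps, as both \<open>I\<close> and its
  complement do here. In the product, on the other hand, every level \<open>n\<close> belongs to \<open>I\<close> or to \<open>J\<close>, so at every scale one of the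
  two factors has a hole of comparable size, and in the maximum metric a hole in one factor
  is a hole in the product.
\<close>

section \<open>Lower porosity, uniform porosity and Baire category\<close>

text \<open>The factor 2 and the supremum only affect the constant: if all holes are smaller than
  \<open>c / 2 * R\<close>, their supremum is at most \<open>c / 2 * R\<close> and the porosity
  quotient is at most \<open>c\<close>.\<close>

lemma lower_porous_at_iff:
  "lower_porous_at m M x \<longleftrightarrow>
    (\<exists>c>0. \<forall>\<^sub>F R in at_right 0. \<exists>r\<ge>c * R. \<exists>z\<in>mspace m. mball_of m z r \<subseteq> mball_of m x R - M)"
    (is "_ \<longleftrightarrow> (\<exists>c>0. eventually (?hole c) _)")
proof
  assume "lower_porous_at m M x"
  then have "0 < Liminf (at_right 0) (\<lambda>R. 2 * porosity_gamma m x R M / ennreal R)"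
    by (simp add: lower_porous_at_def lower_porosity_def)
  \<comment> \<open>Being strictly below the liminf, \<open>d\<close> is finite even when the liminf
    is \<open>\<infinity>\<close>.\<close>
  then obtain d where d: "0 < d" "d < Liminf (at_right 0) (\<lambda>R. 2 * porosity_gamma m x R M / ennreal R)"
    using dense by blast
  then obtain c where c: "d = ennreal c" "c > 0"
    by (cases d) auto
  have "\<forall>\<^sub>F R in at_right 0. ennreal c < 2 * porosity_gamma m x R M / ennreal R"
    using d c less_LiminfD by blast
  moreover have "\<forall>\<^sub>F R::real in at_right 0. R > 0"
    by (simp add: eventually_at_right_less)
  ultimately have "\<forall>\<^sub>F R in at_right 0. ?hole (c / 2) R"
  proof eventually_elim
    case (elim R)
    show ?case
    proof (rule ccontr)
      assume no: "\<not> ?hole (c / 2) R"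
      have "porosity_gamma m x R M \<le> ennreal (c / 2 * R)"
        unfolding porosity_gamma_def using no by (force intro!: Sup_least ennreal_leI)
      then have "2 * porosity_gamma m x R M / ennreal R \<le> 2 * ennreal (c / 2 * R) / ennreal R"
        by (intro divide_right_mono_ennreal mult_left_mono) auto
      also have "\<dots> = ennreal (2 * (c / 2 * R) / R)"
        using elim c by (simp add: divide_ennreal flip: ennreal_numeral ennreal_mult)
      also have "\<dots> = ennreal c"
        using elim by simp
      finally show False using elim by simp
    qed
  qed
  with c show "\<exists>c>0. eventually (?hole c) (at_right 0)"
    by (intro exI[of _ "c / 2"]) auto
next
  assume "\<exists>c>0. eventually (?hole c) (at_right 0)"
  then obtain c where c: "c > 0" "eventually (?hole c) (at_right 0)" by blast
  have "\<forall>\<^sub>F R::real in at_right 0. R > 0"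
    by (simp add: eventually_at_right_less)
  with c(2) have "\<forall>\<^sub>F R in at_right 0. ennreal c \<le> 2 * porosity_gamma m x R M / ennreal R"
  proof eventually_elim
    case (elim R)
    then obtain r z where r: "r \<ge> c * R" "z \<in> mspace m" "mball_of m z r \<subseteq> mball_of m x R - M"
      by blast
    moreover have "c * R > 0" using c elim by simp
    ultimately have "ennreal r \<le> porosity_gamma m x R M"
      unfolding porosity_gamma_def by (intro Sup_upper imageI CollectI) (use order_less_le_trans in blast)
    moreover have "ennreal (c * R) \<le> ennreal r" using r by (intro ennreal_leI) simp
    ultimately have "ennreal (c * R) \<le> porosity_gamma m x R M" by order
    also have "\<dots> \<le> 2 * porosity_gamma m x R M"
      by (simp add: mult_2 add_increasing)
    finally have "ennreal (c * R) / ennreal R \<le> 2 * porosity_gamma m x R M / ennreal R"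
      by (rule divide_right_mono_ennreal)
    then show ?case using elim c by (simp add: divide_ennreal)
  qed
  then have "ennreal c \<le> lower_porosity m M x"
    unfolding lower_porosity_def by (rule Liminf_bounded)
  with c show "lower_porous_at m M x"
    unfolding lower_porous_at_def by (metis ennreal_less_zero_iff order_less_le_trans)
qed

lemma mball_of_euclidean_metric [simp]: "mball_of euclidean_metric x r = ball x r"
  by (auto simp: mball_of_def)

text \<open>One constant limits both the admissible radii and the relative size of the holes, so the
  sequence \<open>1 / Suc k\<close> suffices to exhaust a lower porous set.\<close>

definition uniformly_porous :: "real \<Rightarrow> 'a::metric_space set \<Rightarrow> bool" where
  "uniformly_porous c M \<longleftrightarrow>
    (\<forall>x\<in>M. \<forall>R. 0 < R \<and> R < c \<longrightarrow> (\<exists>r\<ge>c * R. \<exists>z. ball z r \<subseteq> ball x R - M))"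

lemma uniformly_porous_subset:
  assumes "uniformly_porous c M" "N \<subseteq> M"
  shows "uniformly_porous c N"
  unfolding uniformly_porous_def
proof (intro ballI allI impI)
  fix x R assume "x \<in> N" "0 < R \<and> R < c"
  then obtain r z where "r \<ge> c * R" "ball z r \<subseteq> ball x R - M"
    using assms unfolding uniformly_porous_def by blast
  then show "\<exists>r\<ge>c * R. \<exists>z. ball z r \<subseteq> ball x R - N"
    using assms(2) by (intro exI[of _ r] conjI exI[of _ z]) auto
qed

text \<open>A point of the closure has a point of \<open>M\<close> within \<open>R / 2\<close>. The
  hole found there at radius \<open>R / 2\<close> is open, so it misses the closure too; halving the
  radius costs half the constant.\<close>

lemma uniformly_porous_closure:
  assumes "uniformly_porous c M"
  shows "uniformly_porous (c / 2) (closure M)"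
  unfolding uniformly_porous_def
proof (intro ballI allI impI)
  fix x R assume x: "x \<in> closure M" and R: "0 < R \<and> R < c / 2"
  then obtain y where y: "y \<in> M" "dist y x < R / 2"
    using closure_approachable[of x M] by (meson half_gt_zero)
  have "0 < R / 2 \<and> R / 2 < c" using R by auto
  then obtain r z where r: "r \<ge> c * (R / 2)" "ball z r \<subseteq> ball y (R / 2) - M"
    using assms y(1) unfolding uniformly_porous_def by blast
  have "ball y (R / 2) \<subseteq> ball x R"
    using y(2) by (auto simp: subset_iff dist_commute) (smt (verit) dist_triangle dist_commute field_sum_of_halves)
  moreover have "ball z r \<inter> closure M = {}"
    using r(2) by (subst open_Int_closure_eq_empty) auto
  ultimately show "\<exists>r\<ge>c / 2 * R. \<exists>z. ball z r \<subseteq> ball x R - closure M"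
    using r by (intro exI[of _ r] conjI exI[of _ z]) auto
qed

lemma lower_porous_countable_Union_uniformly_porous:
  fixes S :: "'a::metric_space set"
  assumes "lower_porous euclidean_metric S"
  obtains P :: "nat \<Rightarrow> 'a set" where "S = (\<Union>k. P k)" "\<And>k. uniformly_porous (1 / real (Suc k)) (P k)"
proof -
  \<comment> \<open>The holes have to miss all of \<open>S\<close>, hence they miss every piece
    \<open>P k\<close>.\<close>
  define Q where "Q c x \<longleftrightarrow> (\<forall>R. 0 < R \<and> R < c \<longrightarrow> (\<exists>r\<ge>c * R. \<exists>z. ball z r \<subseteq> ball x R - S))" for c x
  define P where "P k = {x\<in>S. Q (1 / real (Suc k)) x}" for k
  have "x \<in> (\<Union>k. P k)" if "x \<in> S" for x
  proof -
    have "lower_porous_at euclidean_metric S x"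
      using assms that by (simp add: lower_porous_def)
    then obtain c where c: "c > 0"
      "\<forall>\<^sub>F R in at_right 0. \<exists>r\<ge>c * R. \<exists>z. ball z r \<subseteq> ball x R - S"
      unfolding lower_porous_at_iff by auto
    then obtain b where b: "b > 0" "\<And>R. 0 < R \<Longrightarrow> R < b \<Longrightarrow> \<exists>r\<ge>c * R. \<exists>z. ball z r \<subseteq> ball x R - S"
      unfolding eventually_at_right_field by auto
    obtain k where k: "1 / real (Suc k) < min c b"
      using c b nat_approx_posE[of "min c b"] by (auto simp: min_less_iff_conj)
    have "Q (1 / real (Suc k)) x"
      unfolding Q_def
    proof (intro allI impI)
      fix R :: real assume R: "0 < R \<and> R < 1 / real (Suc k)"
      then obtain r z where r: "r \<ge> c * R" "ball z r \<subseteq> ball x R - S"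
        using b(2)[of R] k by fastforce
      have "1 / real (Suc k) * R \<le> c * R"
        using k R by (intro mult_right_mono) auto
      then show "\<exists>r\<ge>1 / real (Suc k) * R. \<exists>z. ball z r \<subseteq> ball x R - S"
        using r by (intro exI[of _ r] conjI exI[of _ z]) auto
    qed
    with that show ?thesis by (auto simp: P_def)
  qed
  then have "S = (\<Union>k. P k)" by (auto simp: P_def)
  moreover have "uniformly_porous (1 / real (Suc k)) (P k)" for k
    unfolding uniformly_porous_def P_def Q_def by blast
  ultimately show ?thesis using that by blast
qed

text \<open>Countably many uniformly porous pieces cover \<open>S\<close>. If the closure of each
  had dense complement in \<open>S\<close>, Baire would make the empty intersection of these
  complements dense in \<open>S\<close>. So one closure, again uniformly porous, contains a nonempty
  portion of \<open>S\<close>.\<close>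

lemma sigma_lower_porous_imp_uniformly_porous_portion:
  fixes S :: "'a::{real_normed_vector, heine_borel} set"
  assumes "sigma_lower_porous euclidean_metric S" "closed S" "S \<noteq> {}"
  obtains U c where "open U" "U \<inter> S \<noteq> {}" "c > 0" "uniformly_porous c (U \<inter> S)"
proof -
  obtain \<F> where \<F>: "countable \<F>" "\<And>T. T \<in> \<F> \<Longrightarrow> lower_porous euclidean_metric T" "S = \<Union>\<F>"
    using assms(1) unfolding sigma_lower_porous_def by blast
  have "\<forall>T\<in>\<F>. \<exists>P :: nat \<Rightarrow> 'a set. T = (\<Union>k. P k) \<and> (\<forall>k. uniformly_porous (1 / real (Suc k)) (P k))"
    using \<F>(2) lower_porous_countable_Union_uniformly_porous by metis
  then obtain P :: "'a set \<Rightarrow> nat \<Rightarrow> 'a set" where P: "\<And>T. T \<in> \<F> \<Longrightarrow> T = (\<Union>k. P T k)"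
      "\<And>T k. T \<in> \<F> \<Longrightarrow> uniformly_porous (1 / real (Suc k)) (P T k)"
    by metis
  define G where "G = (\<lambda>(T, k). S - closure (P T k)) ` (\<F> \<times> (UNIV :: nat set))"
  have "\<exists>V\<in>G. \<not> S \<subseteq> closure V"
  proof (rule ccontr)
    assume "\<not> ?thesis"
    moreover have "openin (top_of_set S) V" if "V \<in> G" for V
      using that by (auto simp: G_def Diff_eq intro: openin_open_Int)
    moreover have "countable G" using \<F>(1) by (simp add: G_def)
    ultimately have "S \<subseteq> closure (\<Inter>G)"
      using Baire[OF assms(2)] by blast
    moreover have "\<Inter>G = {}"
    proof -
      have False if "x \<in> \<Inter>G" for x
      proof -
        obtain T where "T \<in> \<F>" using assms(3) \<F>(3) by blast
        then have "x \<in> S" using that by (auto simp: G_def)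
        then obtain T' k where "T' \<in> \<F>" "x \<in> P T' k" using \<F>(3) P(1) by blast
        then show False using that closure_subset by (fastforce simp: G_def)
      qed
      then show ?thesis by blast
    qed
    ultimately show False using assms(3) by simp
  qed
  then obtain T k where T: "T \<in> \<F>" "\<not> S \<subseteq> closure (S - closure (P T k))"
    by (auto simp: G_def)
  \<comment> \<open>The open set around the points of \<open>S\<close> that the dense complement
    fails to approach: inside it, \<open>S\<close> lies entirely in
    \<open>closure (P T k)\<close>.\<close>
  define U where "U = - closure (S - closure (P T k))"
  have "U \<inter> S \<subseteq> closure (P T k)"
    unfolding U_def using closure_subset[of "S - closure (P T k)"] by blast
  then have "uniformly_porous (1 / real (Suc k) / 2) (U \<inter> S)"
    using uniformly_porous_subset uniformly_porous_closure P(2)[OF T(1)] by blast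
  moreover have "open U" "U \<inter> S \<noteq> {}" using T(2) by (auto simp: U_def)
  ultimately show ?thesis by (intro that[of U "1 / real (Suc k) / 2"]) auto
qed

lemma mball_of_max_metric: "mball_of max_metric p r = ball (fst p) r \<times> ball (snd p) r"
  by (auto simp: mball_of_def Metric_space.in_mball[OF Metric_space_max_dist] max_dist_def dist_real_def)

section \<open>Triadic intervals and the removed levels\<close>

lemma mem_D_level_iff:
  "x \<in> D_level n \<longleftrightarrow> (\<exists>i<3 ^ (n - 1). 1 + 3 * real i < x * 3 ^ n \<and> x * 3 ^ n < 2 + 3 * real i)"
  by (auto simp: D_level_def field_simps)

text \<open>Multiplication by \<open>3 ^ m\<close> turns \<open>p\<close> into an integer, whereas
  it turns \<open>D_level m\<close> into open intervals between consecutive integers.\<close>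

lemma triadic_notin_D_level:
  assumes "p * 3 ^ N = of_int j" "N \<le> m"
  shows "p \<notin> D_level m"
proof
  assume "p \<in> D_level m"
  then obtain i where i: "1 + 3 * real i < p * 3 ^ m" "p * 3 ^ m < 2 + 3 * real i"
    unfolding mem_D_level_iff by blast
  have "p * 3 ^ m = p * 3 ^ N * 3 ^ (m - N)"
    using assms(2) by (simp flip: power_add)
  also have "\<dots> = of_int (j * 3 ^ (m - N))" using assms(1) by simp
  finally have "of_int (1 + 3 * int i) < (of_int (j * 3 ^ (m - N)) :: real)"
      "(of_int (j * 3 ^ (m - N)) :: real) < of_int (2 + 3 * int i)"
    using i by simp_all
  then have "1 + 3 * int i < j * 3 ^ (m - N)" "j * 3 ^ (m - N) < 2 + 3 * int i"
    unfolding of_int_less_iff by simp_all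
  then show False by simp
qed

lemma closed_A_set: "closed (A_set I)"
  unfolding A_set_def D_set_def D_level_def
  by (intro closed_Diff open_UN ballI) auto

text \<open>In ternary terms, the \<open>n\<close>-digit expansion of \<open>k\<close> has no digit
  1 at a position in \<open>I\<close>. The condition concerns the open interval from
  \<open>k / 3 ^ n\<close> to \<open>(k + 1) / 3 ^ n\<close>, scaled by \<open>3 ^ n\<close> to
  avoid fractions.\<close>

definition uncut :: "nat set \<Rightarrow> nat \<Rightarrow> nat \<Rightarrow> bool" where
  "uncut I n k \<longleftrightarrow> k < 3 ^ n \<and>
    (\<forall>m\<in>I. m \<le> n \<longrightarrow> (\<forall>y. real k < y * 3 ^ n \<and> y * 3 ^ n < real k + 1 \<longrightarrow> y \<notin> D_level m))"

lemma uncut_cover: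
  assumes "0 \<notin> I" "x \<in> A_set I"
  shows "\<exists>k. uncut I n k \<and> real k \<le> x * 3 ^ n \<and> x * 3 ^ n \<le> real k + 1"
proof (induction n)
  case 0
  have "uncut I 0 0" using assms(1) by (auto simp: uncut_def)
  then show ?case using assms(2) by (auto simp: A_set_def intro!: exI[of _ 0])
next
  case (Suc n)
  then obtain k where k: "uncut I n k" "real k \<le> x * 3 ^ n" "x * 3 ^ n \<le> real k + 1" by blast
  have k3: "k < 3 ^ n" using k by (simp add: uncut_def)
  \<comment> \<open>Division points go to an outer third, so \<open>t = 1\<close> only if
    \<open>x\<close> is strictly inside the middle third, that is, in
    \<open>D_level (Suc n)\<close>.\<close>
  define t where "t = (if x * 3 ^ Suc n \<le> 3 * real k + 1 then 0
                       else if x * 3 ^ Suc n < 3 * real k + 2 then 1 else 2 :: nat)"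
  have t2: "t \<le> 2" by (simp add: t_def)
  have x: "real (3 * k + t) \<le> x * 3 ^ Suc n" "x * 3 ^ Suc n \<le> real (3 * k + t) + 1"
    using k by (auto simp: t_def)
  have t1: "Suc n \<notin> I" if "t = 1"
  proof
    assume "Suc n \<in> I"
    have "1 + 3 * real k < x * 3 ^ Suc n" "x * 3 ^ Suc n < 2 + 3 * real k"
      using that by (auto simp: t_def split: if_splits)
    then have "x \<in> D_level (Suc n)"
      unfolding mem_D_level_iff using k3 by auto
    with \<open>Suc n \<in> I\<close> show False using assms(2) by (auto simp: A_set_def D_set_def)
  qed
  have "y \<notin> D_level m"
    if y: "real (3 * k + t) < y * 3 ^ Suc n" "y * 3 ^ Suc n < real (3 * k + t) + 1"
      and m: "m \<in> I" "m \<le> Suc n" for y m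
  proof (cases "m = Suc n")
    case True
    show ?thesis
    proof
      assume "y \<in> D_level m"
      then obtain i where "1 + 3 * real i < y * 3 ^ Suc n" "y * 3 ^ Suc n < 2 + 3 * real i"
        unfolding mem_D_level_iff True by blast
      with y have "real (3 * k + t) < real (2 + 3 * i)" "real (1 + 3 * i) < real (3 * k + t + 1)"
        by simp_all
      then have "3 * k + t < 2 + 3 * i" "1 + 3 * i < 3 * k + t + 1"
        by (simp_all only: of_nat_less_iff)
      then have "t = 1" using t2 by presburger
      with t1 m True show False by simp
    qed
  next
    case False
    \<comment> \<open>The chosen third lies in its parent interval, which already avoids the earlier
      levels.\<close>
    have "real k < y * 3 ^ n" "y * 3 ^ n < real k + 1" using y t2 by auto
    then show ?thesis using k(1) m False by (simp add: uncut_def)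
  qed
  moreover have "3 * k + t < 3 ^ Suc n" using k3 t2 by simp
  ultimately have "uncut I (Suc n) (3 * k + t)" unfolding uncut_def by blast
  with x show ?case by blast
qed

text \<open>Levels up to \<open>n\<close> are avoided because the interval is uncut, levels in
  \<open>{n<..N}\<close> are not in \<open>I\<close>, and later levels miss all multiples of
  \<open>1 / 3 ^ N\<close>.\<close>

lemma triadic_in_A_set:
  assumes "uncut I n k" "{n<..N} \<inter> I = {}" "real k < p * 3 ^ n" "p * 3 ^ n < real k + 1"
    and "p * 3 ^ N = of_int j"
  shows "p \<in> A_set I"
proof -
  have "p \<notin> D_level m" if "m \<in> I" for m
  proof (cases "m \<le> n")
    case True
    then show ?thesis using assms that by (auto simp: uncut_def)
  next
    case False
    then have "m \<notin> {n<..N}" using assms(2) that by blast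
    with False have "N \<le> m" by simp
    with assms(5) show ?thesis by (rule triadic_notin_D_level)
  qed
  moreover have "p \<ge> 0"
    using assms(3) by (smt (verit) of_nat_0_le_iff zero_less_mult_iff zero_less_power)
  moreover have "p \<le> 1"
  proof -
    have "k + 1 \<le> 3 ^ n" using assms(1) by (simp add: uncut_def)
    then have "real (k + 1) \<le> real (3 ^ n)" by (simp only: of_nat_le_iff)
    then have "1 + real k \<le> 3 ^ n" by simp
    with assms(4) have "p * 3 ^ n < 1 * 3 ^ n" by linarith
    then show ?thesis by simp
  qed
  ultimately show ?thesis by (auto simp: A_set_def D_set_def)
qed

section \<open>Long gaps exclude sigma-lower porosity\<close>

lemma not_sigma_lower_porous_A_set:
  assumes I0: "0 \<notin> I" and gap: "\<And>N L. \<exists>n\<ge>N. {n<..n + L} \<inter> I = {}"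
  shows "\<not> sigma_lower_porous euclidean_metric (A_set I)"
proof
  assume "sigma_lower_porous euclidean_metric (A_set I)"
  moreover have "0 \<notin> D_level m" for m
    by (rule triadic_notin_D_level[of 0 0 0]) auto
  then have "0 \<in> A_set I"
    by (auto simp: A_set_def D_set_def)
  ultimately obtain U c where U: "open U" "U \<inter> A_set I \<noteq> {}" "c > 0" "uniformly_porous c (U \<inter> A_set I)"
    using sigma_lower_porous_imp_uniformly_porous_portion closed_A_set by (metis empty_iff)
  obtain x where x: "x \<in> U" "x \<in> A_set I" using U by blast
  obtain e where e: "e > 0" "ball x e \<subseteq> U" using U(1) x(1) openE by blast
  obtain N where N: "(1 / 3) ^ N < min c e"
    using real_arch_pow_inv[of "min c e" "1 / 3"] U e by auto
  \<comment> \<open>Chosen so that the mesh \<open>R / 3 ^ L\<close> of the net used below is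
    smaller than a hole of radius \<open>c * R\<close>.\<close>
  obtain L where "3 / c < 3 ^ L"
    using real_arch_pow[of 3 "3 / c"] by auto
  then have L: "1 < c * 3 ^ L / 3" using U(3) by (simp add: field_simps)
  obtain n where n: "n \<ge> N" "{n<..n + Suc L} \<inter> I = {}" using gap by blast
  have n1: "1 / 3 ^ n < min c e"
  proof -
    have "(1 / 3 :: real) ^ n \<le> (1 / 3) ^ N" using n(1) by (intro power_decreasing) auto
    with N show ?thesis by (simp add: power_one_over)
  qed
  obtain k where k: "uncut I n k" "real k \<le> x * 3 ^ n" "x * 3 ^ n \<le> real k + 1"
    using uncut_cover[OF I0 x(2)] by blast
  \<comment> \<open>The triadic interval around \<open>x\<close> is shorter than \<open>e\<close>,
    so all of it lies in \<open>U\<close>.\<close>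
  have inU: "y \<in> U" if "real k < y * 3 ^ n" "y * 3 ^ n < real k + 1" for y
  proof -
    have "\<bar>x - y\<bar> * 3 ^ n = \<bar>x * 3 ^ n - y * 3 ^ n\<bar>"
      by (simp add: abs_mult flip: left_diff_distrib)
    also have "\<dots> \<le> 1" using k that by linarith
    finally have "\<bar>x - y\<bar> \<le> 1 / 3 ^ n" by (simp add: field_simps)
    with n1 e show ?thesis by (auto simp: dist_real_def)
  qed
  \<comment> \<open>Since \<open>x\<close> may be an endpoint of its interval, porosity is tested at
    the first division point \<open>w\<close>: it lies on the net, and \<open>ball w R\<close> stays
    strictly inside the interval.\<close>
  define w :: real where "w = (real k + 1 / 3) / 3 ^ n"
  define R :: real where "R = 1 / 3 ^ Suc n"
  have w: "w * 3 ^ n = real k + 1 / 3" by (simp add: w_def)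
  have "w * 3 ^ (n + Suc L) = (w * 3 ^ n) * 3 * 3 ^ L" by (simp add: power_add)
  also have "\<dots> = of_int ((3 * int k + 1) * 3 ^ L)" by (simp add: w)
  finally have "w \<in> A_set I"
    by (rule triadic_in_A_set[OF k(1) n(2), rotated 2]) (use w in linarith)+
  then have "w \<in> U \<inter> A_set I" using inU[of w] w by simp
  moreover have "0 < R \<and> R < c"
    using n1 U(3) by (simp add: R_def field_simps)
  ultimately obtain r z where r: "r \<ge> c * R" "ball z r \<subseteq> ball w R - U \<inter> A_set I"
    using U(4) unfolding uniformly_porous_def by blast
  \<comment> \<open>Rounding the centre \<open>z\<close> of the hole down to the net gives a point
    \<open>p\<close> that is inside the hole and yet belongs to
    \<open>U \<inter> A_set I\<close>.\<close>
  define j where "j = \<lfloor>z * 3 ^ (n + Suc L)\<rfloor>"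
  define p :: real where "p = of_int j / 3 ^ (n + Suc L)"
  have pj: "p * 3 ^ (n + Suc L) = of_int j" by (simp add: p_def)
  have "\<bar>z - p\<bar> * 3 ^ (n + Suc L) = \<bar>z * 3 ^ (n + Suc L) - of_int j\<bar>"
    unfolding pj[symmetric] by (simp add: abs_mult flip: left_diff_distrib)
  also have "\<dots> < 1" unfolding j_def by linarith
  also have "1 < c * R * 3 ^ (n + Suc L)"
    using L U(3) by (simp add: R_def power_add)
  also have "\<dots> \<le> r * 3 ^ (n + Suc L)" using r by (intro mult_right_mono) auto
  finally have "p \<in> ball z r" by (simp add: dist_real_def)
  then have p: "p \<in> ball w R" "p \<notin> U \<inter> A_set I" using r by auto
  have "\<bar>w - p\<bar> * 3 ^ n < R * 3 ^ n" using p(1) by (simp add: dist_real_def)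
  then have "\<bar>w * 3 ^ n - p * 3 ^ n\<bar> < 1 / 3"
    by (simp add: R_def abs_mult flip: left_diff_distrib)
  then have "real k < p * 3 ^ n" "p * 3 ^ n < real k + 1" using w by linarith+
  then have "p \<in> U \<inter> A_set I" using inU triadic_in_A_set[OF k(1) n(2) _ _ pj] by simp
  with p show False by blast
qed

section \<open>Porosity of the product\<close>

text \<open>The point lies in a triadic interval of length \<open>3 / 3 ^ n\<close>, and the hole is
  the whole middle third of that interval.\<close>

lemma D_level_hole:
  assumes "x \<in> {0..1}" "n \<ge> 1"
  shows "\<exists>z. ball z (1 / (2 * 3 ^ n)) \<subseteq> D_level n \<inter> ball x (3 / 3 ^ n)"
proof -
  obtain i where i: "i < 3 ^ (n - 1)" "real i \<le> x * 3 ^ (n - 1)" "x * 3 ^ (n - 1) \<le> real i + 1"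
    \<comment> \<open>With no level removed, \<open>A_set {}\<close> is the unit interval and
      \<open>uncut\<close> only asks for \<open>i < 3 ^ (n - 1)\<close>.\<close>
    using uncut_cover[of "{}" x "n - 1"] assms by (auto simp: A_set_def D_set_def uncut_def)
  have n3: "(3::real) ^ n = 3 * 3 ^ (n - 1)" using assms(2) by (cases n) auto
  have x: "3 * real i \<le> x * 3 ^ n" "x * 3 ^ n \<le> 3 * real i + 3"
    using i by (auto simp: n3)
  define z :: real where "z = (3 / 2 + 3 * real i) / 3 ^ n"
  have "y \<in> D_level n \<inter> ball x (3 / 3 ^ n)" if "y \<in> ball z (1 / (2 * 3 ^ n))" for y
  proof -
    have "\<bar>z - y\<bar> * 3 ^ n < 1 / 2" using that by (simp add: dist_real_def field_simps)
    then have "\<bar>z * 3 ^ n - y * 3 ^ n\<bar> < 1 / 2" by (simp add: abs_mult flip: left_diff_distrib)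
    moreover have "z * 3 ^ n = 3 / 2 + 3 * real i" by (simp add: z_def)
    ultimately have y: "1 + 3 * real i < y * 3 ^ n" "y * 3 ^ n < 2 + 3 * real i" by linarith+
    then have "y \<in> D_level n" using i(1) mem_D_level_iff by blast
    moreover have "\<bar>x * 3 ^ n - y * 3 ^ n\<bar> < 3" using x y by linarith
    then have "\<bar>x - y\<bar> * 3 ^ n < 3" by (simp add: abs_mult flip: left_diff_distrib)
    then have "y \<in> ball x (3 / 3 ^ n)" by (simp add: dist_real_def field_simps)
    ultimately show ?thesis by blast
  qed
  then show ?thesis by blast
qed

text \<open>The least \<open>n\<close> with \<open>3 / 3 ^ n \<le> R\<close> works: its predecessor
  fails, which is the upper bound on \<open>R\<close>, and \<open>R < 1\<close> excludes
  \<open>n = 0\<close>.\<close>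

lemma triadic_scale:
  assumes "0 < R" "R < (1::real)"
  obtains n where "n \<ge> 1" "3 / 3 ^ n \<le> R" "R < 9 / 3 ^ n"
proof -
  obtain N where "(1 / 3) ^ N < R / 3"
    using real_arch_pow_inv[of "R / 3" "1 / 3"] assms by auto
  then have "3 / 3 ^ N \<le> R" by (simp add: power_one_over field_simps)
  define n where "n = (LEAST n. 3 / 3 ^ n \<le> R)"
  have n: "3 / 3 ^ n \<le> R" unfolding n_def using \<open>3 / 3 ^ N \<le> R\<close> by (rule LeastI)
  with assms have "n \<noteq> 0" by (intro notI) simp
  then obtain m where m: "n = Suc m" using not0_implies_Suc by blast
  then have "\<not> 3 / 3 ^ m \<le> R" unfolding n_def by (intro not_less_Least) simp
  then have "R < 9 / 3 ^ n" by (simp add: m field_simps)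
  with n \<open>n \<noteq> 0\<close> show ?thesis using that[of n] by simp
qed

lemma lower_porous_A_set_Times_A_set:
  assumes "{1..} \<subseteq> I \<union> J"
  shows "lower_porous max_metric (A_set I \<times> A_set J)"
  unfolding lower_porous_def
proof (intro conjI ballI)
  show "A_set I \<times> A_set J \<subseteq> mspace max_metric" by simp
next
  fix p assume "p \<in> A_set I \<times> A_set J"
  then obtain x y where p: "p = (x, y)" and xy: "x \<in> A_set I" "y \<in> A_set J" by blast
  then have xy01: "x \<in> {0..1}" "y \<in> {0..1}" by (auto simp: A_set_def)
  \<comment> \<open>The constant comes from \<open>R < 9 / 3 ^ n\<close> and the hole radius
    \<open>1 / (2 * 3 ^ n)\<close>.\<close>
  have "\<exists>r\<ge>1 / 18 * R. \<exists>z\<in>mspace max_metric. mball_of max_metric z r \<subseteq> mball_of max_metric p R - A_set I \<times> A_set J"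
    if R: "R > 0" "R < 1" for R
  proof -
    obtain n where n: "n \<ge> 1" "3 / 3 ^ n \<le> R" "R < 9 / 3 ^ n" using triadic_scale[OF R] by blast
    define r :: real where "r = 1 / (2 * 3 ^ n)"
    have r: "r \<ge> 1 / 18 * R" using n(3) by (simp add: r_def field_simps)
    have rR: "r \<le> R" using n(2) by (simp add: r_def field_simps)
    have sub: "ball u (3 / 3 ^ n) \<subseteq> ball u R" "ball u r \<subseteq> ball u R" for u :: real
      using n(2) rR by (auto intro: subset_ball)
    consider "n \<in> I" | "n \<in> J" using assms n(1) by auto
    then have "\<exists>z. mball_of max_metric z r \<subseteq> mball_of max_metric p R - A_set I \<times> A_set J"
    proof cases
      case 1
      then obtain z where z: "ball z r \<subseteq> D_level n \<inter> ball x (3 / 3 ^ n)"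
        using D_level_hole[OF xy01(1) n(1)] unfolding r_def by blast
      moreover have "D_level n \<inter> A_set I = {}" using 1 by (auto simp: A_set_def D_set_def)
      \<comment> \<open>Only the first coordinate of the centre moves; the second stays within range
        as \<open>r \<le> R\<close>.\<close>
      ultimately have "ball z r \<times> ball y r \<subseteq> ball x R \<times> ball y R - A_set I \<times> A_set J"
        using sub[of x] sub[of y] by blast
      then show ?thesis by (intro exI[of _ "(z, y)"]) (simp add: mball_of_max_metric p)
    next
      case 2
      then obtain z where z: "ball z r \<subseteq> D_level n \<inter> ball y (3 / 3 ^ n)"
        using D_level_hole[OF xy01(2) n(1)] unfolding r_def by blast
      moreover have "D_level n \<inter> A_set J = {}" using 2 by (auto simp: A_set_def D_set_def)
      ultimately have "ball x r \<times> ball z r \<subseteq> ball x R \<times> ball y R - A_set I \<times> A_set J"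
        using sub[of x] sub[of y] by blast
      then show ?thesis by (intro exI[of _ "(x, z)"]) (simp add: mball_of_max_metric p)
    qed
    with r show ?thesis by auto
  qed
  then show "lower_porous_at max_metric (A_set I \<times> A_set J) p"
    unfolding lower_porous_at_iff eventually_at_right_field
    by (intro exI[of _ "1 / 18"] exI[of _ 1] conjI) auto
qed

section \<open>Gaps in the index sets built from squares\<close>

theorem theorem3p10:
  fixes I J :: "nat set"
  assumes "I = (\<Union>i\<in>{1..}. {i\<^sup>2 ..< i\<^sup>2 + i})"
    and "J = {1..} - I"
  shows "closed (A_set I) \<and> closed (A_set J)
    \<and> \<not> sigma_lower_porous euclidean_metric (A_set I)
    \<and> \<not> sigma_lower_porous euclidean_metric (A_set J)
    \<and> lower_porous max_metric (A_set I \<times> A_set J)"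
proof (intro conjI closed_A_set)
  show "\<not> sigma_lower_porous euclidean_metric (A_set I)"
  proof (rule not_sigma_lower_porous_A_set)
    show "0 \<notin> I" by (auto simp: assms(1))
    show "\<exists>n\<ge>N. {n<..n + L} \<inter> I = {}" for N L
    proof (intro exI conjI)
      \<comment> \<open>The gap of \<open>I\<close> from \<open>i\<^sup>2 + i\<close> up to
        \<open>(Suc i)\<^sup>2\<close> contains \<open>i + 1\<close> numbers: blocks with index at
        most \<open>i\<close> have ended and later ones have not begun. As \<open>i > L\<close>,
        this is long enough.\<close>
      define i where "i = N + L + 1"
      have "m \<notin> I" if m: "i\<^sup>2 + i \<le> m" "m < (Suc i)\<^sup>2" for m
      proof
        assume "m \<in> I"
        then obtain j where j: "j\<^sup>2 \<le> m" "m < j\<^sup>2 + j" by (auto simp: assms(1))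
        with m(2) have "j\<^sup>2 < (Suc i)\<^sup>2" by linarith
        then have "j < Suc i" by (rule power2_less_imp_less) simp
        then have "j \<le> i" by simp
        then have "j\<^sup>2 + j \<le> i\<^sup>2 + i" by (intro add_mono power_mono) auto
        with j m show False by linarith
      qed
      moreover have "(Suc i)\<^sup>2 = i\<^sup>2 + 2 * i + 1" by (simp add: power2_eq_square)
      ultimately show "{i\<^sup>2 + i<..i\<^sup>2 + i + L} \<inter> I = {}"
        unfolding disjoint_iff by (auto simp: i_def)
      show "N \<le> i\<^sup>2 + i" by (simp add: i_def)
    qed
  qed
  show "\<not> sigma_lower_porous euclidean_metric (A_set J)"
  proof (rule not_sigma_lower_porous_A_set)
    show "0 \<notin> J" by (simp add: assms(2))
    show "\<exists>n\<ge>N. {n<..n + L} \<inter> J = {}" for N L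
    proof (intro exI conjI)
      \<comment> \<open>Here the gap of \<open>J\<close> is the block of \<open>I\<close> starting
        at \<open>i\<^sup>2\<close>, whose length \<open>i\<close> exceeds \<open>L\<close>.\<close>
      define i where "i = N + L + 1"
      have "m \<in> I" if "i\<^sup>2 < m" "m \<le> i\<^sup>2 + L" for m
        using that by (auto simp: assms(1) i_def intro!: bexI[of _ "N + L + 1"])
      then show "{i\<^sup>2<..i\<^sup>2 + L} \<inter> J = {}" by (auto simp: assms(2))
      show "N \<le> i\<^sup>2" by (simp add: i_def power2_eq_square)
    qed
  qed
  show "lower_porous max_metric (A_set I \<times> A_set J)"
    by (rule lower_porous_A_set_Times_A_set) (auto simp: assms(2))
qed

end
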